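(* Assume Conjecture B (stated in the context). Then for every prime number $b\ge 5$ and every integer $t\ge 0$ with $t\le b/4$, and for every positive integer $n$, the sequence of iterates $(S_{t,b}^k(n))_{k\ge1}$ stabilizes, i.e. eventually reaches a cycle or a fixed point of $S_{t,b}$.
   Context: For integers $t\ge 0$, $b\ge 2$, the $t$-shifted Sloane map in base $b$ is $S_{t,b}(n)=\prod_{i=0}^k (d_i+t)$, where $n=\sum_{i=0}^k d_ib^i$ is the base-$b$ expansion of $n$ ($0\le d_i\le b-1$, $d_k>0$); $S_{t,b}^k$ is its $k$-th iterate. For a base $q$, a digit $d$ and a positive integer $n$, $\#d(n)_q$ is the number of occurrences of $d$ in the base-$q$ expansion of $n$ and $\#(n)_q$ the number of base-$q$ digits of $n$. Given $\varepsilon>0$, $n$ is $\varepsilon$-equidistributed in base $q$ if $\left|\frac{\#d(n)_q}{\#(n)_q}-\frac1q\right|<\varepsilon$ for every $d\in\{0,\dots,q-1\}$. Conjecture B: For every integer $q>1$, every finite set $F=\{p_1,\dots,p_k\}$ of primes that does not contain all primes dividing $q$, and every positive integer $a$, for every $\varepsilon>0$ there exists $N$ such that $a\prod_{i=1}^k p_i^{\alpha_i}$ (nonnegative integers $\alpha_i$) is $\varepsilon$-equidistributed in base $q$ whenever $\alpha_i\ge N$ for some $i$. *)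

theory Defs
  imports Complex_Main "HOL-Computational_Algebra.Primes"
begin

text \<open>Base-\<open>b\<close> digits, least significant first. The expansion of \<open>0\<close> is the single digit \<open>0\<close>;
  the value for \<open>b < 2\<close> only makes the function total.\<close>

function digits :: "nat \<Rightarrow> nat \<Rightarrow> nat list" where
  "digits b n = (if b < 2 \<or> n < b then [n] else (n mod b) # digits b (n div b))"
  by auto
termination
  by (relation "measure snd") (auto intro: div_less_dividend)

declare digits.simps [simp del]

lemma digits_less: "b \<ge> 2 \<Longrightarrow> d \<in> set (digits b n) \<Longrightarrow> d < b"
  by (induction b n rule: digits.induct) (subst (asm) (2) digits.simps, auto split: if_splits)

lemma digits_last_pos:
  "b \<ge> 2 \<Longrightarrow> n > 0 \<Longrightarrow> digits b n \<noteq> [] \<and> last (digits b n) > 0"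
  by (induction b n rule: digits.induct)
     (subst digits.simps, subst (2) digits.simps, auto simp: div_greater_zero_iff)

lemma digits_sum:
  "n = (\<Sum>i<length (digits b n). digits b n ! i * b ^ i)"
proof -
  have "horner_sum (\<lambda>d. d) b (digits b n) = n"
    by (induction b n rule: digits.induct) (subst digits.simps, auto)
  then show ?thesis
    by (simp add: horner_sum_eq_sum lessThan_atLeast0)
qed

definition sloane :: "nat \<Rightarrow> nat \<Rightarrow> nat \<Rightarrow> nat" where
  "sloane t b n = (\<Prod>d\<leftarrow>digits b n. d + t)"

definition equidistributed :: "real \<Rightarrow> nat \<Rightarrow> nat \<Rightarrow> bool" where
  "equidistributed \<epsilon> q n \<longleftrightarrow>
     (\<forall>d\<in>{0..q - 1}.
        \<bar>real (count_list (digits q n) d) / real (length (digits q n)) - 1 / real q\<bar> < \<epsilon>)"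

definition conjecture_B :: bool where
  "conjecture_B \<longleftrightarrow>
     (\<forall>q::nat. \<forall>F::nat set. \<forall>a::nat.
        q > 1 \<longrightarrow> finite F \<longrightarrow> (\<forall>p\<in>F. prime p) \<longrightarrow> \<not> {p. prime p \<and> p dvd q} \<subseteq> F \<longrightarrow> a > 0 \<longrightarrow>
        (\<forall>\<epsilon>>0. \<exists>N::nat. \<forall>\<alpha>::nat \<Rightarrow> nat.
           (\<exists>p\<in>F. \<alpha> p \<ge> N) \<longrightarrow> equidistributed \<epsilon> q (a * (\<Prod>p\<in>F. p ^ \<alpha> p))))"

text \<open>The iterates \<open>f\<^sup>k(x)\<close>, \<open>k \<ge> 1\<close>, eventually reach a point lying on a cycle of \<open>f\<close>;
  period \<open>m = 1\<close> is the case of a fixed point.\<close>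

definition stabilizes :: "('a \<Rightarrow> 'a) \<Rightarrow> 'a \<Rightarrow> bool" where
  "stabilizes f x \<longleftrightarrow> (\<exists>k\<ge>1. \<exists>m\<ge>1. (f ^^ m) ((f ^^ k) x) = (f ^^ k) x)"

end

theory Submission
  imports Defs
begin

text \<open>
  Every nonzero value of the map is a product of numbers below \<open>2 b\<close>, so write it as \<open>b\<^sup>s m\<close>
  with \<open>m\<close> prime to \<open>b\<close> and composed of finitely many primes. Conjecture B makes the digits of a
  large such \<open>m\<close> nearly equidistributed. Since \<open>x \<le> exp (x - 1)\<close>, a number with \<open>L\<close> digits of mean
  \<open>\<mu>\<close> has image at most \<open>b\<^sup>L exp (L ((\<mu> + t) / b - 1))\<close>; here \<open>\<mu>\<close> is close to \<open>(b - 1) / 2\<close> and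
  \<open>t \<le> b / 4\<close>, so the exponent is at most \<open>- L / 8\<close> and \<open>m\<close> is not increased by the map. The \<open>s\<close>
  trailing zeros turn \<open>b\<^sup>s\<close> into \<open>t\<^sup>s \<le> (b / 4)\<^sup>s\<close>, which compensates for the growth of a small \<open>m\<close>
  once \<open>s\<close> is large. Hence the map does not increase its large values, and every orbit is bounded.
\<close>

section \<open>Digit expansions\<close>

lemma digits_mult_base:
  assumes "b \<ge> 2" "n > 0"
  shows "digits b (b * n) = 0 # digits b n"
  using assms by (subst digits.simps) auto

text \<open>Each factor \<open>b\<close> adds a trailing digit 0, which contributes a factor
  \<open>0 + t\<close>. Positivity of \<open>m\<close> matters: the expansion of 0 is a single digit
  and does not grow.\<close>

lemma sloane_power_mult:
  assumes "b \<ge> 2" "m > 0"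
  shows "sloane t b (b ^ s * m) = t ^ s * sloane t b m"
proof (induction s)
  case (Suc s)
  have "sloane t b (b * (b ^ s * m)) = t * sloane t b (b ^ s * m)"
    unfolding sloane_def using assms by (subst digits_mult_base) auto
  with Suc show ?case by (simp add: mult.assoc)
qed simp

lemma digits_nonempty: "digits b n \<noteq> []"
  by (subst digits.simps) auto

lemma power_length_digits_le:
  assumes "b \<ge> 2" "n > 0"
  shows "b ^ (length (digits b n) - 1) \<le> n"
  using assms
proof (induction b n rule: digits.induct)
  case (1 b n)
  show ?case
  proof (cases "n < b")
    case True
    then show ?thesis using 1 by (subst digits.simps) auto
  next
    case False
    then have "b ^ (length (digits b (n div b)) - 1) \<le> n div b"
      using 1 by (auto simp: div_greater_zero_iff)
    then have "b * b ^ (length (digits b (n div b)) - 1) \<le> n"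
      by (metis mult_le_mono2 order_trans times_div_less_eq_dividend)
    \<comment> \<open>Nonempty digit lists make the truncated subtraction of 1 exact.\<close>
    moreover have "b * b ^ (length (digits b (n div b)) - 1) = b ^ length (digits b (n div b))"
      using digits_nonempty[of b "n div b"] by (cases "digits b (n div b)") auto
    ultimately have "b ^ length (digits b (n div b)) \<le> n"
      by simp
    then show ?thesis using False 1 by (subst digits.simps) auto
  qed
qed

lemma less_power_length_digits:
  assumes "b \<ge> 2"
  shows "n < b ^ length (digits b n)"
  using assms
proof (induction b n rule: digits.induct)
  case (1 b n)
  show ?case
  proof (cases "n < b")
    case True
    then show ?thesis by (subst digits.simps) auto
  next
    case False
    then have "n div b < b ^ length (digits b (n div b))"
      using 1 by auto
    then have "n < b ^ length (digits b (n div b)) * b"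
      using 1(2) by (simp add: div_less_iff_less_mult)
    then show ?thesis using False 1 by (subst digits.simps) (auto simp: mult.commute)
  qed
qed

section \<open>Growth of the map on equidistributed numbers\<close>

lemma prod_list_add_le_exp:
  fixes b t :: nat
  assumes "b > 0"
  shows "real (\<Prod>d\<leftarrow>ds. d + t)
    \<le> real b ^ length ds * exp (real (sum_list ds) / b + real (length ds) * (t / b - 1))"
proof (induction ds)
  case (Cons d ds)
  let ?E = "exp (real (sum_list ds) / b + real (length ds) * (t / b - 1))"
  have "real (d + t) / b \<le> exp (real (d + t) / b - 1)"
    using exp_ge_add_one_self[of "real (d + t) / b - 1"] by simp
  then have "real (d + t) \<le> b * exp (real (d + t) / b - 1)"
    using assms by (simp add: field_simps)
  then have "real (d + t) * real (\<Prod>d\<leftarrow>ds. d + t)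
      \<le> (b * exp (real (d + t) / b - 1)) * (real b ^ length ds * ?E)"
    using Cons by (intro mult_mono) auto
  also have "\<dots> = real b ^ length (d # ds) * (exp (real (d + t) / b - 1) * ?E)"
    by simp
  also have "exp (real (d + t) / b - 1) * ?E
      = exp (real (sum_list (d # ds)) / b + real (length (d # ds)) * (t / b - 1))"
    by (simp add: exp_add[symmetric] algebra_simps add_divide_distrib)
  finally show ?case by simp
qed simp

text \<open>Each digit value occurs at most \<open>length * (1 / b + \<epsilon>)\<close> times;
  weighting these bounds by the values produces the sum 0 + ... + (b - 1).\<close>

lemma sum_list_digits_le:
  assumes "b \<ge> 2" "equidistributed \<epsilon> b n"
  shows "real (sum_list (digits b n))
    \<le> real (length (digits b n)) * (1 / b + \<epsilon>) * (real b * (real b - 1) / 2)"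
proof -
  let ?ds = "digits b n"
  have count: "real (count_list ?ds d) \<le> real (length ?ds) * (1 / b + \<epsilon>)" if "d < b" for d
  proof -
    have "d \<in> {0..b - 1}" using that by auto
    then have "\<bar>real (count_list ?ds d) / real (length ?ds) - 1 / real b\<bar> < \<epsilon>"
      using assms(2) unfolding equidistributed_def by blast
    then have "real (count_list ?ds d) / real (length ?ds) \<le> 1 / b + \<epsilon>"
      by linarith
    then show ?thesis
      using digits_nonempty[of b n] by (simp add: field_simps)
  qed
  have gauss: "(\<Sum>d<b. real d) = real b * (real b - 1) / 2"
    by (induction b) (auto simp: field_simps)
  have "sum_list ?ds = (\<Sum>d<b. count_list ?ds d * d)"
    using sum_list_map_eq_sum_count2[of ?ds "{..<b}" "\<lambda>d. d"] digits_less[OF assms(1)] by auto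
  then have "real (sum_list ?ds) = (\<Sum>d<b. real (count_list ?ds d) * real d)"
    by simp
  also have "\<dots> \<le> (\<Sum>d<b. (real (length ?ds) * (1 / b + \<epsilon>)) * real d)"
    using count by (intro sum_mono mult_right_mono) auto
  also have "\<dots> = real (length ?ds) * (1 / b + \<epsilon>) * (real b * (real b - 1) / 2)"
    by (simp only: sum_distrib_left[symmetric] gauss)
  finally show ?thesis .
qed

text \<open>The tolerance \<open>1 / (4 * b)\<close> bounds the mean digit by 5/8 (b - 1), and 5/8 +
  1/4 - 1 = -1/8, so \<open>8 * b\<close> digits push the exponent down to \<open>- b\<close>. Then
  \<open>b * exp (- b) \<le> 1\<close> pays for the gap between \<open>b ^ L\<close> and the lower
  bound \<open>b ^ (L - 1)\<close> for \<open>m\<close>.\<close>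

lemma sloane_le_self_if_equidistributed:
  assumes b: "b \<ge> 2" and t: "real t \<le> real b / 4" and "m > 0"
    and equi: "equidistributed (1 / (4 * real b)) b m"
    and long: "length (digits b m) \<ge> 8 * b"
  shows "sloane t b m \<le> m"
proof -
  let ?L = "length (digits b m)"
  have "(1 / real b + 1 / (4 * real b)) * (real b * (real b - 1) / 2) = 5 / 8 * (real b - 1)"
    using b by (simp add: field_simps)
  then have "real (sum_list (digits b m)) \<le> real ?L * (5 / 8 * (real b - 1))"
    using sum_list_digits_le[OF b equi] by (metis mult.assoc)
  also have "\<dots> \<le> real ?L * (5 / 8 * real b)"
    by (intro mult_left_mono) auto
  finally have sum: "real (sum_list (digits b m)) / b \<le> real ?L * (5 / 8)"
    using b by (simp add: field_simps)
  have "real t / b - 1 \<le> - 3 / 4"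
    using t b by (simp add: field_simps)
  then have "real ?L * (real t / b - 1) \<le> real ?L * (- 3 / 4)"
    by (intro mult_left_mono) auto
  with sum long have exponent:
    "real (sum_list (digits b m)) / b + real ?L * (real t / b - 1) \<le> - real b"
    by linarith
  have "real b \<le> exp (real b)"
    using exp_ge_add_one_self[of "real b"] by linarith
  then have exp_b: "real b * exp (- real b) \<le> 1"
    by (simp add: exp_minus field_simps)
  have "real (sloane t b m)
      \<le> real b ^ ?L * exp (real (sum_list (digits b m)) / b + real ?L * (real t / b - 1))"
    unfolding sloane_def using prod_list_add_le_exp[of b t "digits b m"] b by simp
  also have "\<dots> \<le> real b ^ ?L * exp (- real b)"
    using exponent by (intro mult_left_mono) auto
  also have "\<dots> = real b ^ (?L - 1) * (real b * exp (- real b))"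
    using digits_nonempty[of b m] by (cases "digits b m") auto
  also have "\<dots> \<le> real b ^ (?L - 1)"
    using mult_left_mono[OF exp_b, of "real b ^ (?L - 1)"] by simp
  also have "\<dots> = real (b ^ (?L - 1))"
    by simp
  also have "\<dots> \<le> real m"
    using power_length_digits_le[OF b \<open>m > 0\<close>] of_nat_le_iff by blast
  finally show ?thesis by simp
qed

section \<open>Smooth numbers and Conjecture B\<close>

lemma prod_prime_power_multiplicity:
  fixes n :: nat
  assumes "n > 0" "finite F" "\<And>p. p \<in> F \<Longrightarrow> prime p" "\<And>p. prime p \<Longrightarrow> p dvd n \<Longrightarrow> p \<in> F"
  shows "(\<Prod>p\<in>F. p ^ multiplicity p n) = n"
proof -
  have "(\<Prod>p\<in>F. p ^ multiplicity p n) = (\<Prod>p\<in>prime_factors n. p ^ multiplicity p n)"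
    using assms
    by (intro prod.mono_neutral_right)
      (auto simp: not_dvd_imp_multiplicity_0 in_prime_factors_iff)
  then show ?thesis
    using prod_prime_factors[of n] assms(1) by simp
qed

text \<open>Conjecture B asks for one large exponent. If all exponents of \<open>m\<close> were
  below \<open>N\<close>, then \<open>m\<close> would be at most the product of the
  \<open>p ^ N\<close>, so size alone suffices. The cofactor \<open>a\<close> is taken to be
  1.\<close>

lemma conjecture_B_large_equidistributed:
  assumes "conjecture_B" "q > 1" "finite F" "\<And>p. p \<in> F \<Longrightarrow> prime p"
    "\<not> {p. prime p \<and> p dvd q} \<subseteq> F" "\<epsilon> > 0"
  shows "\<exists>M. \<forall>m>M. (\<forall>p. prime p \<longrightarrow> p dvd m \<longrightarrow> p \<in> F) \<longrightarrow> equidistributed \<epsilon> q m"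
proof -
  obtain N where N: "\<And>\<alpha>. \<exists>p\<in>F. \<alpha> p \<ge> N \<Longrightarrow> equidistributed \<epsilon> q (1 * (\<Prod>p\<in>F. p ^ \<alpha> p))"
    using assms(1)[unfolded conjecture_B_def, rule_format, OF assms(2-5) zero_less_one assms(6)]
    by auto
  have "equidistributed \<epsilon> q m"
    if "m > (\<Prod>p\<in>F. p ^ N)" and F: "\<forall>p. prime p \<longrightarrow> p dvd m \<longrightarrow> p \<in> F" for m
  proof -
    have m: "(\<Prod>p\<in>F. p ^ multiplicity p m) = m"
      using that assms by (intro prod_prime_power_multiplicity) auto
    have "\<exists>p\<in>F. multiplicity p m \<ge> N"
    proof (rule ccontr)
      assume "\<not> ?thesis"
      then have "(\<Prod>p\<in>F. p ^ multiplicity p m) \<le> (\<Prod>p\<in>F. p ^ N)"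
        using assms(4)
        by (intro prod_mono conjI power_increasing)
          (use prime_ge_1_nat in \<open>fastforce simp: not_le\<close>)+
      with m that show False by simp
    qed
    from N[OF this] m show ?thesis by simp
  qed
  then show ?thesis by blast
qed

text \<open>A prime divisor of the product divides some factor \<open>d + t\<close>, which is
  positive because the product is, and \<open>d + t < 2 * b\<close>.\<close>

lemma prime_dvd_sloane_less:
  assumes "b \<ge> 2" "t \<le> b" "sloane t b n > 0" "prime p" "p dvd sloane t b n"
  shows "p < 2 * b"
proof -
  have "\<exists>d\<in>set ds. p dvd d + t" if "p dvd (\<Prod>d\<leftarrow>ds. d + t)" for ds
    using that by (induction ds) (use assms(4) in \<open>auto simp: prime_dvd_mult_iff\<close>)
  then obtain d where d: "d \<in> set (digits b n)" "p dvd d + t"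
    using assms(5) unfolding sloane_def by blast
  have "0 \<notin> (\<lambda>d. d + t) ` set (digits b n)"
    using assms(3) prod_list_zero_iff[of "map (\<lambda>d. d + t) (digits b n)"]
    unfolding sloane_def by simp
  then have "d + t > 0"
    using d(1) by (metis gr0I imageI)
  then have "p \<le> d + t"
    using d(2) by (rule dvd_imp_le[rotated])
  then show ?thesis
    using digits_less[OF assms(1) d(1)] assms(2) by linarith
qed

lemma sloane_le_self_if_smooth:
  assumes "conjecture_B" and "prime b" and t: "real t \<le> real b / 4"
  shows "\<exists>N. \<forall>n>N. (\<forall>p. prime p \<longrightarrow> p dvd n \<longrightarrow> p < 2 * b) \<longrightarrow> sloane t b n \<le> n"
proof -
  have b: "b \<ge> 2" using \<open>prime b\<close> by (rule prime_ge_2_nat)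
  \<comment> \<open>Removing \<open>b\<close>, the only prime divisor of the base, makes Conjecture
    B applicable.\<close>
  define F where "F = {p. prime p \<and> p < 2 * b \<and> p \<noteq> b}"
  have "finite F" by (rule finite_subset[of _ "{..<2 * b}"]) (auto simp: F_def)
  moreover have "\<not> {p. prime p \<and> p dvd b} \<subseteq> F"
    using \<open>prime b\<close> by (auto simp: F_def)
  moreover have "prime p" if "p \<in> F" for p
    using that by (simp add: F_def)
  ultimately obtain M0 where M0: "\<And>m. m > M0 \<Longrightarrow> \<forall>p. prime p \<longrightarrow> p dvd m \<longrightarrow> p \<in> F \<Longrightarrow>
      equidistributed (1 / (4 * real b)) b m"
    using conjecture_B_large_equidistributed[OF assms(1), of b F "1 / (4 * real b)"] b by auto
  \<comment> \<open>The second bound forces more than \<open>8 * b\<close> digits on any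
    \<open>m > M\<close>.\<close>
  define M where "M = max M0 (b ^ (8 * b))"
  \<comment> \<open>\<open>K\<close> bounds the map on the small cofactors; beyond
    \<open>b ^ K * M\<close>, a cofactor \<open>m \<le> M\<close> leaves a power of \<open>b\<close>
    with exponent above \<open>K\<close>.\<close>
  define K where "K = Max (sloane t b ` {..M})"
  have "sloane t b n \<le> n"
    if n: "n > b ^ K * M" and smooth: "\<forall>p. prime p \<longrightarrow> p dvd n \<longrightarrow> p < 2 * b" for n
  proof -
    define s where "s = multiplicity b n"
    from n have "n \<noteq> 0" by simp
    then obtain m where m: "n = b ^ s * m" "\<not> b dvd m"
      using multiplicity_decompose'[of n b] not_prime_unit[of b] \<open>prime b\<close>
      unfolding s_def by metis
    have "m > 0" using m \<open>n \<noteq> 0\<close> by (cases m) auto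
    have S: "sloane t b n = t ^ s * sloane t b m"
      using sloane_power_mult[OF b \<open>m > 0\<close>] m by simp
    show ?thesis
    proof (cases "m > M")
      case True
      have "\<forall>p. prime p \<longrightarrow> p dvd m \<longrightarrow> p \<in> F"
        using smooth m by (auto simp: F_def)
      then have equi: "equidistributed (1 / (4 * real b)) b m"
        using M0 True by (simp add: M_def)
      have "b ^ (8 * b) < b ^ length (digits b m)"
        using True less_power_length_digits[OF b, of m] by (simp add: M_def)
      then have "8 * b < length (digits b m)"
        using b by simp
      then have "sloane t b m \<le> m"
        using sloane_le_self_if_equidistributed[OF b t \<open>m > 0\<close> equi] by simp
      moreover have "t ^ s \<le> b ^ s"
        using t by (intro power_mono) linarith+
      ultimately show ?thesis
        using S m(1) mult_le_mono by metis
    next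
      case False
      then have "sloane t b m \<le> K"
        unfolding K_def by (intro Max_ge) auto
      moreover have "K < s"
      proof (rule ccontr)
        assume "\<not> K < s"
        then have "b ^ s * m \<le> b ^ K * M"
          using False b by (intro mult_le_mono power_increasing) auto
        with n m show False by simp
      qed
      \<comment> \<open>The bound \<open>K\<close> is absorbed by \<open>4 ^ s\<close>, which
        \<open>4 * t \<le> b\<close> turns into \<open>b ^ s\<close>.\<close>
      moreover have "s \<le> 4 ^ s"
        using less_exp[of s] power_mono[of 2 "4::nat" s] by linarith
      ultimately have "t ^ s * sloane t b m \<le> t ^ s * 4 ^ s"
        by (intro mult_le_mono order_refl) linarith
      also have "\<dots> = (t * 4) ^ s"
        by (simp add: power_mult_distrib)
      also have "\<dots> \<le> b ^ s"
        using t by (intro power_mono) linarith+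
      also have "\<dots> \<le> n"
        using m \<open>m > 0\<close> by simp
      finally show ?thesis using S by simp
    qed
  qed
  then show ?thesis by blast
qed

section \<open>Bounded orbits and cycles\<close>

lemma stabilizes_if_bounded:
  fixes f :: "nat \<Rightarrow> nat"
  assumes "\<And>k. (f ^^ Suc k) x \<le> C"
  shows "stabilizes f x"
proof -
  \<comment> \<open>Pigeonhole on the iterates from the first one on, as \<open>stabilizes\<close>
    demands \<open>k \<ge> 1\<close>; a repetition at \<open>i < j\<close> gives the period
    \<open>j - i\<close>.\<close>
  let ?g = "\<lambda>k. (f ^^ Suc k) x"
  have "finite (range ?g)"
    by (rule finite_subset[of _ "{..C}"]) (use assms in auto)
  then have "\<not> inj ?g"
    using finite_imageD infinite_UNIV_nat by blast
  then obtain i j where "i < j" "?g i = ?g j"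
    unfolding inj_on_def by (metis linorder_neqE_nat)
  have "(f ^^ (j - i)) (?g i) = (f ^^ (j - i + Suc i)) x"
    by (simp only: funpow_add o_def)
  also have "\<dots> = ?g i"
    using \<open>i < j\<close> \<open>?g i = ?g j\<close> by (simp del: funpow.simps)
  finally have "(f ^^ (j - i)) (?g i) = ?g i" .
  then show ?thesis
    unfolding stabilizes_def using \<open>i < j\<close>
    by (intro exI[of _ "Suc i"] exI[of _ "j - i"] conjI) auto
qed

text \<open>The hypothesis speaks of values of \<open>f\<close> only, since smoothness is known for
  these and not for the starting point.\<close>

lemma stabilizes_if_eventually_nonincreasing_on_range:
  fixes f :: "nat \<Rightarrow> nat"
  assumes "\<And>n. f n > N \<Longrightarrow> f (f n) \<le> f n"
  shows "stabilizes f x"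
proof (rule stabilizes_if_bounded)
  fix k
  \<comment> \<open>An iterate above \<open>N\<close> does not grow, and one up to \<open>N\<close>
    is sent below the maximum; \<open>f x\<close> starts the induction.\<close>
  let ?C = "max (f x) (Max (f ` {..N}))"
  show "(f ^^ Suc k) x \<le> ?C"
  proof (induction k)
    case (Suc k)
    show ?case
    proof (cases "(f ^^ Suc k) x > N")
      case True
      then show ?thesis using assms[of "(f ^^ k) x"] Suc by simp
    next
      case False
      then have "f ((f ^^ Suc k) x) \<le> Max (f ` {..N})"
        by (intro Max_ge) auto
      then show ?thesis by simp
    qed
  qed simp
qed

theorem theorem19:
  fixes b t n :: nat
  assumes "conjecture_B"
    and "prime b" and "b \<ge> 5"
    and "real t \<le> real b / 4"
    and "n > 0"
  shows "stabilizes (sloane t b) n"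
proof -
  obtain N where N: "\<And>k. k > N \<Longrightarrow> \<forall>p. prime p \<longrightarrow> p dvd k \<longrightarrow> p < 2 * b \<Longrightarrow> sloane t b k \<le> k"
    using sloane_le_self_if_smooth assms by blast
  have "b \<ge> 2" "t \<le> b" using assms by linarith+
  \<comment> \<open>A value above \<open>N\<close> is positive, as the bound on its prime divisors
    requires; the value 0, possible for \<open>t = 0\<close>, is thereby excluded.\<close>
  then have "sloane t b (sloane t b k) \<le> sloane t b k" if "sloane t b k > N" for k
    using that by (intro N) (auto intro: prime_dvd_sloane_less[of b t k])
  then show ?thesis
    by (rule stabilizes_if_eventually_nonincreasing_on_range)
qed

end
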